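(* Let $\mathbb X$ be a nonempty finite set of points of the projective space $\mathbb P^{s-1}$ over a field $K$, let $I=I(\mathbb X)\subset S=K[t_1,\dots,t_s]$ be its vanishing ideal, and for $d\ge1$ let $\delta_{\mathbb X}(d)$ be the minimum distance of $C_{\mathbb X}(d)$. Then $\delta_{\mathbb X}(d)=1$ if and only if $d\ge\mathrm v(I)$.
   Context: $S=\bigoplus_{d\ge 0}S_d$ has the standard grading; $\mathbb X=\{P_1,\dots,P_n\}$, each $P_i$ represented by the coordinate vector whose first nonzero coordinate is $1$; $I(\mathbb X)$ is the ideal generated by the homogeneous polynomials vanishing on $\mathbb X$. The projective Reed–Muller-type code $C_{\mathbb X}(d)$ is the image of the linear map $S_d\to K^n$, $f\mapsto(f(P_1),\dots,f(P_n))$. The minimum distance of a linear code $C\subset K^n$ is the minimum number of nonzero entries of a nonzero vector of $C$. v-number: for a graded ideal $I\subsetneq\mathfrak m=(t_1,\dots,t_s)$, $\mathrm v(I)=\min\{d\ge1 : \exists f\in S_d,\ \exists\,\mathfrak p\in\mathrm{Ass}(S/I)\text{ with }(I:f)=\mathfrak p\}$. *)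

theory Defs
  imports
    "HOL-Analysis.Analysis"
    "HOL-Library.Poly_Mapping"
    "HOL-Algebra.Algebraic_Closure_Type"
begin

section \<open>Polynomial rings over a field\<close>

text \<open>
  The polynomial ring \<open>S = K[t\<^sub>i | i :: 's]\<close> is the monoid algebra over \<open>K\<close> of the monoid of
  exponent vectors, so \<open>s = CARD('s)\<close>; the linear order on the index type \<open>'s\<close> is the order of
  the coordinates.
\<close>

type_synonym ('k, 's) mpoly = "('s \<Rightarrow>\<^sub>0 nat) \<Rightarrow>\<^sub>0 'k"

abbreviation poly_ring :: "('k::field, 's::finite) mpoly ring" where
  "poly_ring \<equiv> ring_of_type_algebra"

definition peval :: "('k::field, 's::finite) mpoly \<Rightarrow> 'k ^ 's \<Rightarrow> 'k" where
  "peval f v = (\<Sum>m\<in>Poly_Mapping.keys f. Poly_Mapping.lookup f m * (\<Prod>i\<in>UNIV. (v $ i) ^ Poly_Mapping.lookup m i))"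

text \<open>The component \<open>S\<^sub>d\<close> of the standard grading; it contains \<open>0\<close>.\<close>

definition homog :: "nat \<Rightarrow> ('k::field, 's::finite) mpoly set" where
  "homog d = {f. \<forall>m\<in>Poly_Mapping.keys f. (\<Sum>i\<in>UNIV. Poly_Mapping.lookup m i) = d}"


section \<open>Projective space and vanishing ideals\<close>

text \<open>A point of projective space is the set of all its homogeneous coordinate vectors.\<close>

type_synonym ('k, 's) point = "('k ^ 's) set"

definition proj_space :: "('k::field, 's::finite) point set" where
  "proj_space = (UNIV - {0}) // {(v, w). v \<noteq> 0 \<and> w \<noteq> 0 \<and> (\<exists>c. c \<noteq> 0 \<and> w = c *s v)}"

definition normalized :: "('k::field, 's::{finite, linorder}) vec \<Rightarrow> bool" where
  "normalized v \<longleftrightarrow> (\<exists>i. v $ i = 1 \<and> (\<forall>j<i. v $ j = 0))"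

definition std_rep :: "('k::field, 's::{finite, linorder}) point \<Rightarrow> ('k, 's) vec" where
  "std_rep p = (THE v. v \<in> p \<and> normalized v)"

lemma proj_spaceE:
  fixes p :: "('k::field, 's::finite) point"
  assumes "p \<in> proj_space"
  obtains v where "v \<noteq> 0" "p = {c *s v | c. c \<noteq> 0}"
proof -
  obtain v where v: "v \<noteq> 0" "p = {w. w \<noteq> 0 \<and> (\<exists>c. c \<noteq> 0 \<and> w = c *s v)}"
    using assms unfolding proj_space_def by (elim quotientE) auto
  have "p = {c *s v | c. c \<noteq> 0}"
    using v by auto
  thus thesis
    using v(1) that by blast
qed

lemma std_rep_unique:
  fixes p :: "('k::field, 's::{finite, linorder}) point"
  assumes "p \<in> proj_space"
  shows "\<exists>!v. v \<in> p \<and> normalized v"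
proof -
  obtain v where v: "v \<noteq> 0" "p = {c *s v | c. c \<noteq> 0}"
    using assms by (rule proj_spaceE)
  have ne: "{i. v $ i \<noteq> 0} \<noteq> {}"
    using v(1) by (auto simp: vec_eq_iff)
  define i where "i = Min {i. v $ i \<noteq> 0}"
  have i: "v $ i \<noteq> 0"
    using Min_in[OF _ ne] unfolding i_def by simp
  have below: "v $ j = 0" if "j < i" for j
  proof (rule ccontr)
    assume "v $ j \<noteq> 0"
    hence "i \<le> j"
      unfolding i_def by (intro Min_le) auto
    thus False
      using that by simp
  qed
  have "inverse (v $ i) *s v \<in> p"
    unfolding v(2) using i by (intro CollectI exI[of _ "inverse (v $ i)"]) simp
  moreover have "normalized (inverse (v $ i) *s v)"
    unfolding normalized_def using i below by (intro exI[of _ i]) simp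
  moreover have "w = inverse (v $ i) *s v" if w: "w \<in> p" "normalized w" for w
  proof -
    obtain c where c: "c \<noteq> 0" "w = c *s v"
      using v(2) w(1) by blast
    obtain k where k: "c * v $ k = 1" "\<forall>j<k. v $ j = 0"
      using w(2) c unfolding normalized_def by auto
    have "k = i"
    proof (rule antisym)
      show "k \<le> i" using k(2) i by (metis not_le)
      show "i \<le> k" using k(1) below by (metis mult_zero_right not_le zero_neq_one)
    qed
    thus ?thesis
      using k(1) i c by (simp add: field_simps)
  qed
  ultimately show ?thesis by blast
qed

definition vanishing_ideal :: "('k::field, 's::finite) point set \<Rightarrow> ('k, 's) mpoly set" where
  "vanishing_ideal Xs = genideal poly_ring
     {f. (\<exists>e. f \<in> homog e) \<and> (\<forall>p\<in>Xs. \<forall>v\<in>p. peval f v = 0)}"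


section \<open>Associated primes and the v-number\<close>

definition colon :: "('k::field, 's::finite) mpoly set \<Rightarrow> ('k, 's) mpoly \<Rightarrow> ('k, 's) mpoly set" where
  "colon I f = {g. g * f \<in> I}"

text \<open>
  The associated primes of the \<open>S\<close>-module \<open>S/I\<close>: the prime ideals that are annihilators of an
  element \<open>x\<close> of \<open>S/I\<close>, where \<open>g\<close> acts as multiplication by its residue class.
\<close>

definition ass_primes :: "('k::field, 's::finite) mpoly set \<Rightarrow> ('k, 's) mpoly set set" where
  "ass_primes I = {\<pp>. primeideal \<pp> poly_ring \<and>
     (\<exists>x\<in>carrier (poly_ring Quot I).
        \<pp> = {g. (I +>\<^bsub>poly_ring\<^esub> g) \<otimes>\<^bsub>poly_ring Quot I\<^esub> x = \<zero>\<^bsub>poly_ring Quot I\<^esub>})}"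

text \<open>Intended for graded ideals strictly contained in the ideal generated by the variables.\<close>

definition vnumber :: "('k::field, 's::finite) mpoly set \<Rightarrow> nat" where
  "vnumber I = (LEAST d. 1 \<le> d \<and> (\<exists>f\<in>homog d. \<exists>\<pp>\<in>ass_primes I. colon I f = \<pp>))"


section \<open>Projective Reed--Muller-type codes\<close>

definition hamming_weight :: "'k::field ^ 'n::finite \<Rightarrow> nat" where
  "hamming_weight c = card {i. c $ i \<noteq> 0}"

text \<open>Meaningful for nonzero codes only.\<close>

definition min_distance :: "('k::field ^ 'n::finite) set \<Rightarrow> nat" where
  "min_distance C = (LEAST w. \<exists>c\<in>C. c \<noteq> 0 \<and> hamming_weight c = w)"

text \<open>
  The points are given by an enumeration \<open>P\<close> indexed by \<open>'n\<close>, so the code has length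
  \<open>CARD('n)\<close>.
\<close>

definition rm_code ::
  "('n::finite \<Rightarrow> ('k::field, 's::{finite, linorder}) point) \<Rightarrow> nat \<Rightarrow> ('k ^ 'n) set" where
  "rm_code P d = (\<lambda>f. \<chi> i. peval f (std_rep (P i))) ` homog d"

lemma peval_superset:
  fixes f :: "('k::field, 's::finite) mpoly"
  assumes "finite A" "Poly_Mapping.keys f \<subseteq> A"
  shows "peval f v = (\<Sum>m\<in>A. Poly_Mapping.lookup f m * (\<Prod>i\<in>UNIV. (v $ i) ^ Poly_Mapping.lookup m i))"
  unfolding peval_def by (rule sum.mono_neutral_left) (use assms in \<open>auto simp: in_keys_iff\<close>)

lemma peval_add: "peval (f + g) v = peval f v + peval g v"
proof -
  define A where "A = Poly_Mapping.keys f \<union> Poly_Mapping.keys g"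
  have A: "finite A" "Poly_Mapping.keys f \<subseteq> A" "Poly_Mapping.keys g \<subseteq> A" "Poly_Mapping.keys (f + g) \<subseteq> A"
    unfolding A_def using Poly_Mapping.keys_add[of f g] by auto
  show ?thesis
    unfolding peval_superset[OF A(1,2)] peval_superset[OF A(1,3)] peval_superset[OF A(1,4)]
    by (simp add: lookup_add distrib_right sum.distrib)
qed

lemma peval_scale: "peval (Poly_Mapping.map ((*) c) f) v = c * peval f v"
proof -
  have A: "Poly_Mapping.keys (Poly_Mapping.map ((*) c) f) \<subseteq> Poly_Mapping.keys f"
    by (auto simp: in_keys_iff Poly_Mapping.map.rep_eq when_def)
  show ?thesis
    unfolding peval_superset[OF finite_keys A] peval_superset[OF finite_keys order_refl, of f]
    by (auto simp: Poly_Mapping.map.rep_eq when_def sum_distrib_left mult.assoc in_keys_iff intro!: sum.cong)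
qed

lemma rm_code_subspace: "vec.subspace (rm_code P d)"
proof (rule vec.subspaceI)
  have "0 \<in> homog d"
    by (simp add: homog_def)
  thus "0 \<in> rm_code P d"
    unfolding rm_code_def by (intro image_eqI[of _ _ 0]) (auto simp: vec_eq_iff peval_def)
next
  fix x y
  assume "x \<in> rm_code P d" "y \<in> rm_code P d"
  then obtain f g where fg: "f \<in> homog d" "g \<in> homog d"
      "x = (\<chi> i. peval f (std_rep (P i)))" "y = (\<chi> i. peval g (std_rep (P i)))"
    unfolding rm_code_def by blast
  have "f + g \<in> homog d"
    using fg(1,2) Poly_Mapping.keys_add[of f g] unfolding homog_def by blast
  thus "x + y \<in> rm_code P d"
    unfolding rm_code_def using fg(3,4)
    by (intro image_eqI[of _ _ "f + g"]) (auto simp: vec_eq_iff peval_add)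
next
  fix c x
  assume "x \<in> rm_code P d"
  then obtain f where f: "f \<in> homog d" "x = (\<chi> i. peval f (std_rep (P i)))"
    unfolding rm_code_def by blast
  have "Poly_Mapping.map ((*) c) f \<in> homog d"
    using f(1) unfolding homog_def by (auto simp: in_keys_iff Poly_Mapping.map.rep_eq when_def)
  thus "c *s x \<in> rm_code P d"
    unfolding rm_code_def using f(2)
    by (intro image_eqI[of _ _ "Poly_Mapping.map ((*) c) f"]) (auto simp: vec_eq_iff peval_scale)
qed

end

theory Submission
  imports Defs
begin

text \<open>
  Restricting \<open>f\<close> to the line through a coordinate vector \<open>v\<close> gives a ring homomorphism
  \<open>f \<mapsto> f(Tv)\<close> into the domain \<open>K[T]\<close>, whose coefficients are the values at \<open>v\<close> of the homogeneous
  components of \<open>f\<close>. Its kernel is therefore the prime ideal of the point, and \<open>I(\<X>)\<close> is the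
  intersection of these kernels. Hence \<open>(I : f)\<close>, for \<open>f \<in> S\<^sub>d\<close>, is the intersection of the ideals of the
  points at which \<open>f\<close> does not vanish. As distinct points are separated by linear forms, this is prime
  exactly when \<open>f\<close> vanishes at all points of \<open>\<X>\<close> but one, that is, when \<open>f\<close> gives a codeword of
  weight one. Such \<open>f\<close> exist in some degree (products of linear forms) and in every larger degree
  (multiply by a coordinate that is nonzero at the remaining point).
\<close>

abbreviation tdeg :: "('s::finite \<Rightarrow>\<^sub>0 nat) \<Rightarrow> nat" where
  "tdeg m \<equiv> \<Sum>i\<in>UNIV. Poly_Mapping.lookup m i"

abbreviation mon_eval :: "('k::field, 's::finite) vec \<Rightarrow> ('s \<Rightarrow>\<^sub>0 nat) \<Rightarrow> 'k" where
  "mon_eval v m \<equiv> \<Prod>i\<in>UNIV. (v $ i) ^ Poly_Mapping.lookup m i"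

section \<open>Restriction to a line\<close>

text \<open>The variable \<open>T\<close> stays an indeterminate: over a finite field an
  inhomogeneous polynomial can vanish at every multiple of \<open>v\<close> although its components
  do not vanish at \<open>v\<close>.\<close>

definition line_eval :: "('k::field, 's::finite) vec \<Rightarrow> ('k, 's) mpoly \<Rightarrow> 'k Polynomial.poly" where
  "line_eval v f = (\<Sum>m\<in>Poly_Mapping.keys f.
     Polynomial.monom (Poly_Mapping.lookup f m * mon_eval v m) (tdeg m))"

lemma line_eval_superset:
  assumes "finite A" "Poly_Mapping.keys f \<subseteq> A"
  shows "line_eval v f = (\<Sum>m\<in>A. Polynomial.monom (Poly_Mapping.lookup f m * mon_eval v m) (tdeg m))"
  unfolding line_eval_def by (rule sum.mono_neutral_left) (use assms in \<open>auto simp: in_keys_iff\<close>)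

lemma line_eval_add: "line_eval v (f + g) = line_eval v f + line_eval v g"
proof -
  define A where "A = Poly_Mapping.keys f \<union> Poly_Mapping.keys g"
  have A: "finite A" "Poly_Mapping.keys f \<subseteq> A" "Poly_Mapping.keys g \<subseteq> A" "Poly_Mapping.keys (f + g) \<subseteq> A"
    unfolding A_def using Poly_Mapping.keys_add[of f g] by auto
  show ?thesis
    unfolding line_eval_superset[OF A(1,2)] line_eval_superset[OF A(1,3)] line_eval_superset[OF A(1,4)]
    unfolding sum.distrib[symmetric] Polynomial.add_monom
    by (simp only: lookup_add distrib_right)
qed

lemma line_eval_0 [simp]: "line_eval v 0 = 0"
  by (simp add: line_eval_def)

lemma line_eval_sum: "line_eval v (sum f A) = (\<Sum>a\<in>A. line_eval v (f a))"
  by (induction A rule: infinite_finite_induct) (simp_all add: line_eval_add)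

lemma line_eval_single:
  "line_eval v (Poly_Mapping.single m c) = Polynomial.monom (c * mon_eval v m) (tdeg m)"
  by (simp add: line_eval_def)

lemma mpoly_eq_sum_single:
  fixes f :: "('k::field, 's::finite) mpoly"
  shows "f = (\<Sum>m\<in>Poly_Mapping.keys f. Poly_Mapping.single m (Poly_Mapping.lookup f m))"
  by (rule poly_mapping_eqI)
     (auto simp: lookup_sum lookup_single when_def sum.delta' in_keys_iff)

text \<open>By bilinearity it suffices to treat single terms, where total degrees add and monomial
  values multiply.\<close>

lemma line_eval_mult: "line_eval v (f * g) = line_eval v f * line_eval v g"
proof -
  let ?s = "\<lambda>f m. Poly_Mapping.single m (Poly_Mapping.lookup f m)"
  let ?K = Poly_Mapping.keys
  have "f * g = (\<Sum>m\<in>?K f. ?s f m) * (\<Sum>n\<in>?K g. ?s g n)"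
    by (simp only: mpoly_eq_sum_single[symmetric])
  also have "\<dots> = (\<Sum>m\<in>?K f. \<Sum>n\<in>?K g. ?s f m * ?s g n)"
    by (rule sum_product)
  finally have "line_eval v (f * g) = (\<Sum>m\<in>?K f. \<Sum>n\<in>?K g. line_eval v (?s f m * ?s g n))"
    by (simp only: line_eval_sum)
  also have "\<dots> = (\<Sum>m\<in>?K f. \<Sum>n\<in>?K g. line_eval v (?s f m) * line_eval v (?s g n))"
    by (simp add: mult_single line_eval_single lookup_add sum.distrib power_add prod.distrib
        mult_monom mult_ac)
  also have "\<dots> = line_eval v f * line_eval v g"
    unfolding line_eval_single by (simp only: sum_product line_eval_def)
  finally show ?thesis .
qed

lemma poly_line_eval_1: "poly (line_eval v f) 1 = peval f v"
  by (simp add: line_eval_def peval_def poly_sum poly_monom)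

lemma line_eval_homog:
  assumes "f \<in> homog d"
  shows "line_eval v f = Polynomial.monom (peval f v) d"
  using assms unfolding line_eval_def peval_def homog_def by (simp add: monom_sum)

lemma peval_0 [simp]: "peval 0 v = 0"
  by (simp add: peval_def)

lemma peval_sum: "peval (sum f A) v = (\<Sum>a\<in>A. peval (f a) v)"
  by (induction A rule: infinite_finite_induct) (simp_all add: peval_add)

lemma peval_single: "peval (Poly_Mapping.single m c) v = c * mon_eval v m"
  by (simp add: peval_def)

text \<open>Setting \<open>T = 1\<close> in \<open>line_eval_mult\<close>.\<close>

lemma peval_mult: "peval (f * g) v = peval f v * peval g v"
  by (simp add: line_eval_mult flip: poly_line_eval_1)

lemma peval_homog_scale:
  assumes "f \<in> homog d"
  shows "peval f (c *s v) = c ^ d * peval f v"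
  using assms unfolding peval_def homog_def
  by (simp add: power_mult_distrib prod.distrib sum_distrib_left mult_ac flip: power_sum)

section \<open>Homogeneous polynomials\<close>

lemma homog_add:
  assumes "f \<in> homog d" "g \<in> homog d"
  shows "f + g \<in> homog d"
  using assms Poly_Mapping.keys_add[of f g] unfolding homog_def by blast

lemma homog_sum:
  assumes "\<And>a. a \<in> A \<Longrightarrow> f a \<in> homog d"
  shows "sum f A \<in> homog d"
  using assms
proof (induction A rule: infinite_finite_induct)
  case (insert a A)
  thus ?case
    by (simp add: homog_add)
qed (simp_all add: homog_def)

lemma homog_single:
  assumes "tdeg m = d"
  shows "Poly_Mapping.single m c \<in> homog d"
  using assms by (simp add: homog_def)

lemma homog_mult:
  assumes "f \<in> homog d" "g \<in> homog e"
  shows "f * g \<in> homog (d + e)"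
  using assms keys_mult[of f g] unfolding homog_def by (force simp: lookup_add sum.distrib)

lemma homog_one: "1 \<in> homog 0"
  by (simp add: homog_def)

lemma peval_one: "peval 1 v = 1"
  by (simp add: peval_def)

definition hcomp :: "nat \<Rightarrow> ('k::field, 's::finite) mpoly \<Rightarrow> ('k, 's) mpoly" where
  "hcomp e f = (\<Sum>m\<in>{m \<in> Poly_Mapping.keys f. tdeg m = e}.
     Poly_Mapping.single m (Poly_Mapping.lookup f m))"

lemma hcomp_homog: "hcomp e f \<in> homog e"
  unfolding hcomp_def by (intro homog_sum homog_single) auto

lemma sum_hcomp: "(\<Sum>e\<in>tdeg ` Poly_Mapping.keys f. hcomp e f) = f"
  using sum.image_gen[of "Poly_Mapping.keys f" "\<lambda>m. Poly_Mapping.single m (Poly_Mapping.lookup f m)" tdeg]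
  unfolding hcomp_def mpoly_eq_sum_single[of f, symmetric] by simp

text \<open>This turns the vanishing of a polynomial along a line into the vanishing of all its
  homogeneous components at \<open>v\<close>.\<close>

lemma peval_hcomp: "peval (hcomp e f) v = Polynomial.coeff (line_eval v f) e"
  unfolding hcomp_def peval_sum peval_single line_eval_def Polynomial.coeff_sum
  by (simp add: sum.inter_filter)

abbreviation scaled_var :: "'s::finite \<Rightarrow> 'k::field \<Rightarrow> ('k, 's) mpoly" where
  "scaled_var i c \<equiv> Poly_Mapping.single (Poly_Mapping.single i (Suc 0)) c"

lemma scaled_var_homog: "scaled_var i c \<in> homog 1"
  by (rule homog_single) (simp add: lookup_single when_def)

lemma peval_scaled_var: "peval (scaled_var i c) v = c * v $ i"
proof -
  have "mon_eval v (Poly_Mapping.single i (Suc 0)) = (\<Prod>j\<in>UNIV. if j = i then v $ j else 1)"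
    by (rule prod.cong) (auto simp: lookup_single when_def)
  thus ?thesis
    by (simp add: peval_single)
qed

section \<open>Separation of points\<close>

lemma normalized_nonzero: "normalized v \<Longrightarrow> v \<noteq> 0"
  by (auto simp: normalized_def)

lemma normalized_scale_eq:
  assumes "normalized v" "normalized (c *s v)"
  shows "c *s v = v"
proof -
  obtain i where i: "v $ i = 1" "\<forall>j<i. v $ j = 0"
    using assms(1) unfolding normalized_def by blast
  obtain k where k: "c * v $ k = 1" "\<forall>j<k. c * v $ j = 0"
    using assms(2) unfolding normalized_def by auto
  \<comment> \<open>Both \<open>i\<close> and \<open>k\<close> are the position of the first nonzero
    coordinate of \<open>v\<close>.\<close>
  have "\<not> k < i" "\<not> i < k"
    using i k by auto
  hence "c = 1"
    using i(1) k(1) by (metis linorder_neq_iff mult.right_neutral)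
  thus ?thesis
    by simp
qed

text \<open>Where \<open>v $ i = 1\<close>, the forms \<open>v $ j * t_i - t_j\<close> all vanish at
  \<open>v\<close>. If all of them vanished at \<open>w\<close> too, then \<open>w\<close> would be
  \<open>w $ i\<close> times \<open>v\<close>, which normalization excludes.\<close>

lemma separating_linear_form:
  assumes "normalized v" "normalized w" "v \<noteq> w"
  obtains f where "f \<in> homog 1" "peval f v = 0" "peval f w \<noteq> 0"
proof -
  obtain i where i: "v $ i = 1"
    using assms(1) unfolding normalized_def by blast
  have "w \<noteq> (w $ i) *s v"
    using normalized_scale_eq[of v "w $ i"] assms by metis
  then obtain j where j: "w $ j \<noteq> w $ i * v $ j"
    by (auto simp: vec_eq_iff)
  define f where "f = scaled_var i (v $ j) + scaled_var j (- 1)"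
  have ev: "peval f u = v $ j * u $ i - u $ j" for u
    unfolding f_def peval_add peval_scaled_var by simp
  show ?thesis
  proof (rule that)
    show "f \<in> homog 1"
      unfolding f_def by (intro homog_add scaled_var_homog)
    show "peval f v = 0" "peval f w \<noteq> 0"
      using i j by (auto simp: ev mult.commute)
  qed
qed

text \<open>Take the product of one separating linear form for each point of
  \<open>U\<close>.\<close>

lemma separating_form:
  assumes "finite U" "\<And>u. u \<in> U \<Longrightarrow> normalized u" "normalized v" "v \<notin> U"
  shows "\<exists>f\<in>homog (card U). peval f v \<noteq> 0 \<and> (\<forall>u\<in>U. peval f u = 0)"
  using assms
proof (induction U rule: finite_induct)
  case empty
  show ?case
    by (intro bexI[of _ 1]) (simp_all add: peval_one homog_one)
next
  case (insert u U)
  then obtain f where f: "f \<in> homog (card U)" "peval f v \<noteq> 0" "\<forall>u\<in>U. peval f u = 0"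
    by auto
  obtain l where l: "l \<in> homog 1" "peval l u = 0" "peval l v \<noteq> 0"
    using insert.prems by (auto intro: separating_linear_form[of u v])
  have "l * f \<in> homog (card (insert u U))"
    using homog_mult[OF l(1) f(1)] insert.hyps by simp
  thus ?case
    using f l by (intro bexI[of _ "l * f"]) (auto simp: peval_mult)
qed

lemma std_rep:
  assumes "p \<in> proj_space"
  shows std_rep_in: "std_rep p \<in> p" and std_rep_normalized: "normalized (std_rep p)"
  using theI'[OF std_rep_unique[OF assms]] unfolding std_rep_def by auto

lemma point_eq_std_rep:
  assumes "p \<in> proj_space"
  shows "p = {c *s std_rep p | c. c \<noteq> 0}"
proof -
  obtain v where v: "v \<noteq> 0" "p = {c *s v | c. c \<noteq> 0}"
    using assms by (rule proj_spaceE)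
  obtain c where c: "c \<noteq> 0" "std_rep p = c *s v"
    using std_rep_in[OF assms] v(2) by blast
  have "b *s v = (b / c) *s std_rep p" and "b *s std_rep p = (b * c) *s v" for b
    using c by simp_all
  hence "(\<exists>b. w = b *s v \<and> b \<noteq> 0) \<longleftrightarrow> (\<exists>b. w = b *s std_rep p \<and> b \<noteq> 0)" for w
    using c(1) by (metis divide_eq_0_iff mult_eq_0_iff)
  thus ?thesis
    by (subst v(2)) blast
qed

lemma std_rep_inj_on: "inj_on std_rep proj_space"
proof (rule inj_onI)
  fix p q :: "('k::field, 's::{finite, linorder}) point"
  assume p: "p \<in> proj_space" and q: "q \<in> proj_space" and eq: "std_rep p = std_rep q"
  show "p = q"
    by (rule trans[OF point_eq_std_rep[OF p]], rule trans[OF _ point_eq_std_rep[OF q, symmetric]])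
       (simp only: eq)
qed

section \<open>The vanishing ideal\<close>

text \<open>This translates ideals of the record-based ring into type class operations. Closure
  under negation comes from multiplication by \<open>- 1\<close>.\<close>

lemma ideal_ring_of_type_algebra_iff:
  fixes I :: "'a::comm_ring_1 set"
  shows "ideal I ring_of_type_algebra \<longleftrightarrow>
    0 \<in> I \<and> (\<forall>a\<in>I. \<forall>b\<in>I. a + b \<in> I) \<and> (\<forall>a\<in>I. \<forall>x. x * a \<in> I)"
    (is "?L \<longleftrightarrow> ?R")
proof
  assume ?L
  then interpret ideal I "ring_of_type_algebra :: 'a ring" .
  show ?R
    using additive_subgroup.zero_closed[OF is_additive_subgroup]
      additive_subgroup.a_closed[OF is_additive_subgroup] I_l_closed
    by (simp add: ring_of_type_algebra_def)
next
  assume R: ?R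
  interpret cring "ring_of_type_algebra :: 'a ring"
    by (rule cring_from_type_algebra)
  have inv: "\<exists>b\<in>I. a + b = 0" if "a \<in> I" for a
  proof -
    have "(- 1) * a \<in> I"
      using R that by blast
    thus ?thesis
      by (intro bexI[of _ "- a"]) auto
  qed
  show ?L
  proof (rule idealI)
    show "subgroup I (add_monoid (ring_of_type_algebra :: 'a ring))"
    proof (rule add.subgroupI)
      show "\<ominus>\<^bsub>ring_of_type_algebra\<^esub> a \<in> I" if a: "a \<in> I" for a
      proof -
        obtain b where b: "b \<in> I" "a + b = 0"
          using inv[OF a] by blast
        have "\<ominus>\<^bsub>ring_of_type_algebra\<^esub> a = b"
          by (rule minus_equality) (use b in \<open>auto simp: ring_of_type_algebra_def add.commute\<close>)
        thus ?thesis
          using b by simp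
      qed
    qed (use R in \<open>auto simp: ring_of_type_algebra_def\<close>)
  qed (use R in \<open>auto simp: ring_of_type_algebra_def mult.commute intro: ring_axioms[unfolded ring_of_type_algebra_def]\<close>)
qed

text \<open>For \<open>V = {}\<close> this is the whole ring, which is not prime; this accounts for
  forms that vanish at all points.\<close>

definition line_ideal :: "('k::field, 's::finite) vec set \<Rightarrow> ('k, 's) mpoly set" where
  "line_ideal V = {f. \<forall>v\<in>V. line_eval v f = 0}"

lemma ideal_line_ideal: "ideal (line_ideal V) poly_ring"
  unfolding ideal_ring_of_type_algebra_iff
  by (auto simp: line_ideal_def line_eval_add line_eval_mult)

lemma vanishing_ideal_eq_line_ideal:
  fixes Xs :: "('k::field, 's::{finite, linorder}) point set"
  assumes "Xs \<subseteq> proj_space"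
  shows "vanishing_ideal Xs = line_ideal (std_rep ` Xs)"
proof -
  let ?G = "{f. (\<exists>e. f \<in> homog e) \<and> (\<forall>p\<in>Xs. \<forall>v\<in>p. peval f v = 0)} :: ('k, 's) mpoly set"
  have "?G \<subseteq> line_ideal (std_rep ` Xs)"
    using assms by (fastforce simp: line_ideal_def line_eval_homog dest: std_rep_in)
  hence "genideal poly_ring ?G \<subseteq> line_ideal (std_rep ` Xs)"
    unfolding genideal_def using ideal_line_ideal by blast
  \<comment> \<open>The generated ideal is the intersection of all ideals containing the generators,
    so an arbitrary such \<open>I\<close> is considered. Each homogeneous component of
    \<open>f\<close> is itself a generator.\<close>
  moreover have "f \<in> I" if f: "f \<in> line_ideal (std_rep ` Xs)"
    and I: "ideal I poly_ring" "?G \<subseteq> I" for f and I :: "('k, 's) mpoly set"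
  proof -
    have "peval (hcomp e f) v = 0" if p: "p \<in> Xs" "v \<in> p" for e p v
    proof -
      obtain c where "v = c *s std_rep p"
        using point_eq_std_rep[of p] p assms by blast
      moreover have "peval (hcomp e f) (std_rep p) = 0"
        using f p(1) by (simp add: peval_hcomp line_ideal_def)
      ultimately show ?thesis
        by (simp add: peval_homog_scale[OF hcomp_homog])
    qed
    hence "hcomp e f \<in> I" for e
      using I(2) hcomp_homog by blast
    hence "(\<Sum>e\<in>E. hcomp e f) \<in> I" for E
      by (induction E rule: infinite_finite_induct)
         (use I(1) in \<open>auto simp: ideal_ring_of_type_algebra_iff\<close>)
    thus ?thesis
      using sum_hcomp[of f] by metis
  qed
  ultimately show ?thesis
    unfolding vanishing_ideal_def genideal_def by blast
qed

section \<open>Colon ideals and their primality\<close>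

text \<open>Since \<open>K[T]\<close> is a domain, \<open>g * f\<close> vanishes along a line iff
  one factor does; lines where \<open>f\<close> vanishes impose no condition on
  \<open>g\<close>.\<close>

lemma colon_line_ideal: "colon (line_ideal V) f = line_ideal {v \<in> V. line_eval v f \<noteq> 0}"
  by (auto simp: colon_def line_ideal_def line_eval_mult)

text \<open>The kernel of a homomorphism into the domain \<open>K[T]\<close> is prime; it is proper
  because \<open>1\<close> maps to \<open>1\<close>.\<close>

lemma primeideal_line_ideal_singleton: "primeideal (line_ideal {v}) poly_ring"
proof (rule primeidealI[OF ideal_line_ideal cring_from_type_algebra])
  have "line_eval v 1 = 1"
    by (subst line_eval_homog[OF homog_one]) (simp add: peval_one)
  hence "1 \<notin> line_ideal {v}"
    by (simp add: line_ideal_def)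
  thus "carrier poly_ring \<noteq> line_ideal {v}"
    by (auto simp: ring_of_type_algebra_def)
qed (auto simp: ring_of_type_algebra_def line_ideal_def line_eval_mult)

lemma primeideal_line_ideal_iff:
  fixes W :: "('k::field, 's::{finite, linorder}) vec set"
  assumes "finite W" "\<And>w. w \<in> W \<Longrightarrow> normalized w"
  shows "primeideal (line_ideal W) poly_ring \<longleftrightarrow> card W = 1"
proof
  assume prime: "primeideal (line_ideal W) poly_ring"
  have "W \<noteq> {}"
    using primeideal.I_notcarr[OF prime] by (auto simp: line_ideal_def ring_of_type_algebra_def)
  then obtain v where v: "v \<in> W"
    by blast
  have "w = v" if w: "w \<in> W" for w
  proof (rule ccontr)
    assume "w \<noteq> v"
    then obtain h where h: "h \<in> homog 1" "peval h v = 0" "peval h w \<noteq> 0"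
      using assms(2) v w by (metis separating_linear_form)
    \<comment> \<open>With two points in \<open>W\<close>, primality fails: \<open>g\<close>
      vanishes on \<open>W\<close> except at \<open>v\<close>, while \<open>h\<close> vanishes at
      \<open>v\<close> but not at \<open>w\<close>. So \<open>g * h\<close> lies in the ideal and
      neither factor does.\<close>
    obtain g where g: "g \<in> homog (card (W - {v}))" "peval g v \<noteq> 0" "\<forall>u\<in>W - {v}. peval g u = 0"
      using separating_form[of "W - {v}" v] assms v by auto
    have "g * h \<in> line_ideal W"
      using g h by (auto simp: line_ideal_def line_eval_mult line_eval_homog)
    hence "g \<in> line_ideal W \<or> h \<in> line_ideal W"
      using primeideal.I_prime[OF prime, of g h] by (simp add: ring_of_type_algebra_def)
    thus False
      using g h v w by (auto simp: line_ideal_def line_eval_homog)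
  qed
  hence "W = {v}"
    using v by blast
  thus "card W = 1"
    by simp
next
  assume "card W = 1"
  thus "primeideal (line_ideal W) poly_ring"
    by (metis card_1_singletonE primeideal_line_ideal_singleton)
qed

text \<open>The colon ideal is the annihilator of the residue class of \<open>f\<close>, so this
  class serves as the \<open>x\<close> in \<open>ass_primes\<close> and only primality
  remains.\<close>

lemma colon_mem_ass_primes_iff:
  fixes I :: "('k::field, 's::finite) mpoly set"
  assumes "ideal I poly_ring"
  shows "colon I f \<in> ass_primes I \<longleftrightarrow> primeideal (colon I f) poly_ring"
proof -
  interpret ideal I "poly_ring :: ('k, 's) mpoly ring"
    by fact
  have carr: "g \<in> carrier (poly_ring :: ('k, 's) mpoly ring)" for g
    by (simp add: ring_of_type_algebra_def)
  have "(I +>\<^bsub>poly_ring\<^esub> g) \<otimes>\<^bsub>poly_ring Quot I\<^esub> (I +>\<^bsub>poly_ring\<^esub> f) = \<zero>\<^bsub>poly_ring Quot I\<^esub>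
      \<longleftrightarrow> g * f \<in> I" for g
  proof -
    have "(I +>\<^bsub>poly_ring\<^esub> g) \<otimes>\<^bsub>poly_ring Quot I\<^esub> (I +>\<^bsub>poly_ring\<^esub> f)
        = I +>\<^bsub>poly_ring\<^esub> (g \<otimes>\<^bsub>poly_ring\<^esub> f)"
      using rcoset_mult_add[OF carr carr] by (simp add: FactRing_def)
    moreover have "I +>\<^bsub>poly_ring\<^esub> h = I \<longleftrightarrow> h \<in> I" for h
      using a_rcos_const a_rcos_self[OF carr, of h] by auto
    ultimately show ?thesis
      by (simp add: FactRing_def) (simp add: ring_of_type_algebra_def)
  qed
  moreover have "I +>\<^bsub>poly_ring\<^esub> f \<in> carrier (poly_ring Quot I)"
    using carr by (auto simp: FactRing_def intro: a_rcosetsI a_subset[THEN subsetD])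
  ultimately show ?thesis
    unfolding ass_primes_def colon_def by (auto intro!: bexI[of _ "I +>\<^bsub>poly_ring\<^esub> f"])
qed

section \<open>Indicator forms\<close>

text \<open>The common meeting point of both sides of the theorem: codewords of weight one, and
  forms with prime colon ideal.\<close>

definition has_indicator_form :: "('k::field, 's::finite) vec set \<Rightarrow> nat \<Rightarrow> bool" where
  "has_indicator_form V d \<longleftrightarrow> (\<exists>f\<in>homog d. card {v \<in> V. peval f v \<noteq> 0} = 1)"

lemma has_indicator_form_Suc:
  assumes "has_indicator_form V d" "\<And>v. v \<in> V \<Longrightarrow> v \<noteq> 0"
  shows "has_indicator_form V (Suc d)"
proof -
  obtain f v where f: "f \<in> homog d" "{v \<in> V. peval f v \<noteq> 0} = {v}"
    using assms(1) unfolding has_indicator_form_def by (metis card_1_singletonE)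
  have "v \<noteq> 0"
    using f(2) assms(2) by blast
  then obtain i where i: "v $ i \<noteq> 0"
    by (auto simp: vec_eq_iff)
  have "{u \<in> V. peval (scaled_var i 1 * f) u \<noteq> 0} = {v}"
    using f(2) i by (auto simp: peval_mult peval_scaled_var)
  thus ?thesis
    unfolding has_indicator_form_def using homog_mult[OF scaled_var_homog f(1)]
    by (intro bexI[of _ "scaled_var i 1 * f"]) simp_all
qed

lemma has_indicator_form_mono:
  assumes "has_indicator_form V d" "d \<le> e" "\<And>v. v \<in> V \<Longrightarrow> v \<noteq> 0"
  shows "has_indicator_form V e"
  using assms(2)
proof (induction rule: dec_induct)
  case (step n)
  thus ?case
    by (intro has_indicator_form_Suc assms(3))
qed (rule assms(1))

lemma has_indicator_form_exists:
  fixes V :: "('k::field, 's::{finite, linorder}) vec set"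
  assumes "finite V" "\<And>v. v \<in> V \<Longrightarrow> normalized v" "V \<noteq> {}"
  shows "has_indicator_form V (card V)"
proof -
  obtain v where v: "v \<in> V"
    using assms(3) by blast
  obtain f where f: "f \<in> homog (card (V - {v}))" "peval f v \<noteq> 0" "\<forall>u\<in>V - {v}. peval f u = 0"
    using separating_form[of "V - {v}" v] assms v by auto
  have "{u \<in> V. peval f u \<noteq> 0} = {v}"
    using f v by auto
  hence "has_indicator_form V (card (V - {v}))"
    unfolding has_indicator_form_def using f(1) by (intro bexI[of _ f]) simp_all
  \<comment> \<open>The degree \<open>card V - 1\<close> is 0 for a single point, whereas
    \<open>vnumber\<close> ranges over degrees at least 1; hence the passage to
    \<open>card V\<close>.\<close>
  thus ?thesis
    by (rule has_indicator_form_mono)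
       (use assms normalized_nonzero in \<open>auto simp: card_Diff_subset_Int\<close>)
qed

text \<open>The degrees admitting an indicator form are upward closed, so \<open>d\<close> is one of
  them iff it is at least their minimum.\<close>

lemma vnumber_le_iff:
  fixes V :: "('k::field, 's::{finite, linorder}) vec set"
  assumes "finite V" "\<And>v. v \<in> V \<Longrightarrow> normalized v" "V \<noteq> {}" "1 \<le> d"
  shows "vnumber (line_ideal V) \<le> d \<longleftrightarrow> has_indicator_form V d"
proof -
  have prime_iff: "colon (line_ideal V) f \<in> ass_primes (line_ideal V)
      \<longleftrightarrow> card {v \<in> V. peval f v \<noteq> 0} = 1" if "f \<in> homog e" for f e
    unfolding colon_mem_ass_primes_iff[OF ideal_line_ideal] unfolding colon_line_ideal
    using assms(1,2) that by (subst primeideal_line_ideal_iff) (auto simp: line_eval_homog)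
  let ?Q = "\<lambda>e. 1 \<le> e \<and> has_indicator_form V e"
  have vn: "vnumber (line_ideal V) = (LEAST e. ?Q e)"
    unfolding vnumber_def has_indicator_form_def using prime_iff
    by (intro arg_cong[where f = Least] ext) auto
  \<comment> \<open>Some degree qualifies, so the \<open>LEAST\<close> is attained.\<close>
  have "?Q (card V)"
    using has_indicator_form_exists[OF assms(1-3)] assms(1,3)
    by (simp add: Suc_le_eq card_gt_0_iff)
  hence "?Q (LEAST e. ?Q e)"
    by (rule LeastI)
  thus ?thesis
    unfolding vn using assms(2,4) normalized_nonzero
    by (metis (no_types, lifting) Least_le has_indicator_form_mono)
qed

section \<open>Minimum distance and codewords of weight one\<close>

text \<open>The nonzero codeword \<open>c\<close> ensures that the minimum is attained; no nonzero
  word has weight below 1.\<close>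

lemma min_distance_eq_1_iff:
  assumes "c \<in> C" "c \<noteq> 0"
  shows "min_distance C = 1 \<longleftrightarrow> (\<exists>c\<in>C. hamming_weight c = 1)"
proof -
  let ?P = "\<lambda>w. \<exists>c\<in>C. c \<noteq> 0 \<and> hamming_weight c = w"
  have wt: "hamming_weight c \<noteq> 0 \<longleftrightarrow> c \<noteq> 0" for c :: "'a ^ 'b"
    by (auto simp: hamming_weight_def vec_eq_iff)
  have "?P (hamming_weight c)"
    using assms by blast
  hence least: "?P (min_distance C)"
    unfolding min_distance_def by (rule LeastI)
  moreover have "min_distance C = 1" if "?P 1"
    unfolding min_distance_def
    by (rule Least_equality) (use that wt in \<open>auto simp: Suc_le_eq\<close>)
  ultimately show ?thesis
    using wt by (metis zero_neq_one)
qed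

lemma rm_code_nonzero:
  fixes P :: "'n::finite \<Rightarrow> ('k::field, 's::{finite, linorder}) point"
  assumes "P j \<in> proj_space"
  shows "\<exists>c\<in>rm_code P d. c \<noteq> 0"
proof -
  \<comment> \<open>For a single point the constant 1 is an indicator form of degree 0; monotonicity
    lifts it to degree \<open>d\<close>.\<close>
  have "has_indicator_form {std_rep (P j)} 0"
    unfolding has_indicator_form_def
    by (intro bexI[of _ 1]) (simp_all add: peval_one homog_one)
  hence "has_indicator_form {std_rep (P j)} d"
    by (rule has_indicator_form_mono)
       (use std_rep_normalized[OF assms] normalized_nonzero in auto)
  then obtain f where "f \<in> homog d" "peval f (std_rep (P j)) \<noteq> 0"
    unfolding has_indicator_form_def by (metis (mono_tags, lifting) card_1_singletonE insertI1 mem_Collect_eq singletonD)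
  thus ?thesis
    unfolding rm_code_def by (auto simp: vec_eq_iff)
qed

theorem corollary5p6:
  fixes Xs :: "('k::field, 's::{finite, linorder}) point set"
    and P :: "'n::finite \<Rightarrow> ('k, 's) point"
    and d :: nat
  assumes "Xs \<subseteq> proj_space" and "finite Xs" and "Xs \<noteq> {}"
    and "bij_betw P UNIV Xs"
    and "1 \<le> d"
  shows "min_distance (rm_code P d) = 1 \<longleftrightarrow> vnumber (vanishing_ideal Xs) \<le> d"
proof -
  let ?V = "std_rep ` Xs" and ?r = "\<lambda>i. std_rep (P i)"
  have range: "P ` UNIV = Xs" and injP: "inj P"
    using assms(4) by (auto simp: bij_betw_def)
  have inj: "inj ?r"
    using std_rep_inj_on range assms(1)
    by (intro injI injD[OF injP]) (auto dest!: inj_onD[OF std_rep_inj_on])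
  \<comment> \<open>As \<open>?r\<close> is injective, counting nonzero coordinates amounts to
    counting points where \<open>f\<close> is nonzero.\<close>
  have weight: "hamming_weight (\<chi> i. peval f (?r i)) = card {v \<in> ?V. peval f v \<noteq> 0}" for f
  proof -
    have "{v \<in> ?V. peval f v \<noteq> 0} = ?r ` {i. peval f (?r i) \<noteq> 0}"
      using range by auto
    thus ?thesis
      by (simp add: hamming_weight_def card_image inj_on_subset[OF inj])
  qed
  obtain c where c: "c \<in> rm_code P d" "c \<noteq> 0"
    using rm_code_nonzero range assms(1) by blast
  have "min_distance (rm_code P d) = 1 \<longleftrightarrow> has_indicator_form ?V d"
    unfolding min_distance_eq_1_iff[OF c] has_indicator_form_def
    by (auto simp: rm_code_def weight)
  also have "\<dots> \<longleftrightarrow> vnumber (vanishing_ideal Xs) \<le> d"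
    unfolding vanishing_ideal_eq_line_ideal[OF assms(1)]
    by (subst vnumber_le_iff) (use assms std_rep_normalized in auto)
  finally show ?thesis .
qed

end
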